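(* Let $\mathcal{H}$ be a real Hilbert space and $\mathcal{D}\subset\mathcal{H}$ a dictionary with $\|g\|=1$ for all $g\in\mathcal{D}$ which is complete in $\mathcal{H}$ (i.e. the linear span of $\mathcal{D}$ is dense in $\mathcal{H}$). Then for any $f\in\mathcal{H}$ and any sequence $(f_N)$ generated by either the orthogonal greedy algorithm (OGA) or the relaxed greedy algorithm (RGA, with either of the two choices of $(\alpha_k)$ given in the context) applied to $f$, the approximation error $\|r_N\|=\|f-f_N\|$ tends to zero as $N\to+\infty$.
   Context: OGA: $f_0=0$, $r_0=f$; for $k\ge1$ choose $g_k\in\mathcal{D}$ with $|\langle r_{k-1},g_k\rangle|=\max_{g\in\mathcal{D}}|\langle r_{k-1},g\rangle|$, let $f_k$ be the orthogonal projection of $f$ onto $\mathrm{Span}\{g_1,\dots,g_k\}$ and $r_k=f-f_k$. RGA: $f_0=0$; for $k\ge1$, $f_k=\alpha_kf_{k-1}+\beta_kg_k$, where $(\beta_k,g_k)$ is a minimizer of $\|f-\alpha_kf_{k-1}-\beta g\|$ over $(\beta,g)\in\mathbb{R}\times\mathcal{D}$, and $r_k=f-f_k$; the sequence $(\alpha_k)$ is either $\alpha_k=1-\frac1k$ ($k\ge1$), or $\alpha_1=0$, $\alpha_k=1-\frac2k$ ($k>1$). *)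

theory Defs
  imports "HOL-Analysis.Analysis"
begin

definition dictionary :: "'a::real_inner set \<Rightarrow> bool" where
  "dictionary D \<longleftrightarrow> (\<forall>g\<in>D. norm g = 1) \<and> closure (span D) = UNIV"

definition is_orthogonal_projection :: "'a::real_inner set \<Rightarrow> 'a \<Rightarrow> 'a \<Rightarrow> bool" where
  "is_orthogonal_projection V f p \<longleftrightarrow> p \<in> V \<and> (\<forall>v\<in>V. orthogonal (f - p) v)"

text \<open>
  A maximizer or minimizer over the dictionary need not exist and need not be unique.
  Hence the two algorithms are relations: \<open>oga D f F\<close> and \<open>rga D \<alpha> f F\<close> say that \<open>F\<close> is
  the sequence of approximants of some run on \<open>f\<close> in which every extremum is attained.
\<close>

definition oga :: "'a::real_inner set \<Rightarrow> 'a \<Rightarrow> (nat \<Rightarrow> 'a) \<Rightarrow> bool" where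
  "oga D f F \<longleftrightarrow> F 0 = 0 \<and>
    (\<exists>g :: nat \<Rightarrow> 'a. \<forall>k\<ge>1.
       is_arg_max (\<lambda>h. \<bar>(f - F (k - 1)) \<bullet> h\<bar>) (\<lambda>h. h \<in> D) (g k) \<and>
       is_orthogonal_projection (span (g ` {1..k})) f (F k))"

definition rga :: "'a::real_inner set \<Rightarrow> (nat \<Rightarrow> real) \<Rightarrow> 'a \<Rightarrow> (nat \<Rightarrow> 'a) \<Rightarrow> bool" where
  "rga D \<alpha> f F \<longleftrightarrow> F 0 = 0 \<and>
    (\<exists>(\<beta> :: nat \<Rightarrow> real) (g :: nat \<Rightarrow> 'a). \<forall>k\<ge>1.
       is_arg_min (\<lambda>(b, h). norm (f - \<alpha> k *\<^sub>R F (k - 1) - b *\<^sub>R h)) (\<lambda>(b, h). h \<in> D) (\<beta> k, g k) \<and>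
       F k = \<alpha> k *\<^sub>R F (k - 1) + \<beta> k *\<^sub>R g k)"

definition rga_weights :: "(nat \<Rightarrow> real) \<Rightarrow> bool" where
  "rga_weights \<alpha> \<longleftrightarrow>
     (\<forall>k\<ge>1. \<alpha> k = 1 - 1 / real k) \<or>
     (\<alpha> 1 = 0 \<and> (\<forall>k>1. \<alpha> k = 1 - 2 / real k))"

end

theory Submission
  imports Defs
begin

text \<open>
  Everything rests on a bound \<open>\<bar>w \<bullet> h\<bar> \<le> M * sup {\<bar>w \<bullet> g\<bar> | g. g \<in> D}\<close> for a fixed \<open>h\<close> in the span
  of the dictionary, applied to \<open>h\<close> close to \<open>f\<close>.
  For the orthogonal algorithm, \<open>norm (r\<^sub>k)\<^sup>2 \<le> norm (r\<^sub>k\<^sub>-\<^sub>1)\<^sup>2 - (r\<^sub>k\<^sub>-\<^sub>1 \<bullet> g\<^sub>k)\<^sup>2\<close>, so \<open>norm r\<^sub>k\<close> decreases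
  to a limit \<open>L\<close> and \<open>r\<^sub>k\<^sub>-\<^sub>1 \<bullet> g\<^sub>k\<close> tends to 0; since \<open>norm (r\<^sub>k)\<^sup>2 = r\<^sub>k \<bullet> f\<close>, the bound gives
  \<open>L\<^sup>2 \<le> L * norm (f - h)\<close>.
  For the relaxed algorithm with \<open>a = 1 - \<alpha>\<^sub>k\<close>, testing minimality with the coefficients \<open>\<plusminus>a M\<close> gives
  \<open>norm (r\<^sub>k)\<^sup>2 \<le> (1 - a) norm (r\<^sub>k\<^sub>-\<^sub>1)\<^sup>2 + a norm (f - h)\<^sup>2 + a\<^sup>2 M\<^sup>2\<close>, and \<open>1/k \<le> a \<le> 2/k\<close> forces
  the limes superior of \<open>norm (r\<^sub>k)\<^sup>2\<close> below \<open>norm (f - h)\<^sup>2\<close>.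
\<close>

section \<open>Inner products with the span, density, and best approximation\<close>

lemma span_inner_bound:
  fixes h :: "'a::real_inner"
  assumes "h \<in> span D"
  shows "\<exists>M>0. \<forall>w S. 0 \<le> S \<longrightarrow> (\<forall>g\<in>D. \<bar>w \<bullet> g\<bar> \<le> S) \<longrightarrow> \<bar>w \<bullet> h\<bar> \<le> M * S"
  using assms
proof (induction rule: span_induct_alt)
  case base
  \<comment> \<open>\<open>M\<close> becomes 1 plus the sum of the absolute coefficients in
    \<open>h\<close>; starting at 1 keeps it positive, since the relaxed step divides by it.\<close>
  show ?case by (intro exI[of _ 1]) auto
next
  case (step c x y)
  from step.IH obtain M where M: "M > 0"
    "\<And>w S. 0 \<le> S \<Longrightarrow> \<forall>g\<in>D. \<bar>w \<bullet> g\<bar> \<le> S \<Longrightarrow> \<bar>w \<bullet> y\<bar> \<le> M * S" by blast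
  have "\<bar>w \<bullet> (c *\<^sub>R x + y)\<bar> \<le> (\<bar>c\<bar> + M) * S" if "0 \<le> S" "\<forall>g\<in>D. \<bar>w \<bullet> g\<bar> \<le> S" for w S
  proof -
    have "\<bar>w \<bullet> (c *\<^sub>R x + y)\<bar> \<le> \<bar>c\<bar> * \<bar>w \<bullet> x\<bar> + \<bar>w \<bullet> y\<bar>"
      by (metis abs_mult abs_triangle_ineq inner_add_right inner_scaleR_right)
    also have "\<dots> \<le> \<bar>c\<bar> * S + M * S"
      using M(2)[OF that] that \<open>x \<in> D\<close> by (intro add_mono mult_left_mono) auto
    finally show ?thesis by (simp add: distrib_right)
  qed
  with M(1) show ?case by (intro exI[of _ "\<bar>c\<bar> + M"]) auto
qed

lemma dictionary_approx:
  assumes "dictionary D" "\<epsilon> > 0"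
  obtains h where "h \<in> span D" "norm (f - h) < \<epsilon>"
proof -
  have "f \<in> closure (span D)" using assms by (simp add: dictionary_def)
  with \<open>\<epsilon> > 0\<close> obtain h where "h \<in> span D" "dist h f < \<epsilon>"
    by (auto simp: closure_approachable)
  then show thesis by (intro that) (simp_all add: dist_norm norm_minus_commute)
qed

lemma orthogonal_projection_best:
  assumes "is_orthogonal_projection V f p" "subspace V" "q \<in> V"
  shows "norm (f - p) \<le> norm (f - q)"
proof -
  have "orthogonal (f - p) (p - q)"
    using assms by (simp add: is_orthogonal_projection_def subspace_diff)
  then have "(norm (f - q))\<^sup>2 = (norm (f - p))\<^sup>2 + (norm (p - q))\<^sup>2"
    using norm_add_Pythagorean[of "f - p" "p - q"] by simp
  then have "(norm (f - p))\<^sup>2 \<le> (norm (f - q))\<^sup>2"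
    using zero_le_power2[of "norm (p - q)"] by linarith
  then show ?thesis by (rule power2_le_imp_le) simp
qed

section \<open>Convergence of the orthogonal greedy algorithm\<close>

lemma oga_converges:
  assumes D: "dictionary D" and "oga D f F"
  shows "(\<lambda>N. norm (f - F N)) \<longlonglongrightarrow> 0"
proof -
  from \<open>oga D f F\<close> obtain g where F0: "F 0 = 0"
    and run: "\<forall>k\<ge>1. is_arg_max (\<lambda>h. \<bar>(f - F (k - 1)) \<bullet> h\<bar>) (\<lambda>h. h \<in> D) (g k) \<and>
      is_orthogonal_projection (span (g ` {1..k})) f (F k)"
    unfolding oga_def by blast
  have max: "is_arg_max (\<lambda>h. \<bar>(f - F k) \<bullet> h\<bar>) (\<lambda>h. h \<in> D) (g (Suc k))"
    and proj: "is_orthogonal_projection (span (g ` {1..Suc k})) f (F (Suc k))" for k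
    using run[rule_format, of "Suc k"] by simp_all
  define r where "r k = f - F k" for k
  define s where "s k = \<bar>r k \<bullet> g (Suc k)\<bar>" for k
  have gD: "g (Suc k) \<in> D" and s_max: "\<And>h. h \<in> D \<Longrightarrow> \<bar>r k \<bullet> h\<bar> \<le> s k" for k
    using max[of k] by (auto simp: is_arg_max_linorder r_def s_def)
  \<comment> \<open>\<open>proj\<close> starts at index 1; at index 0 the span of the empty set is
    {0} and \<open>F 0 = 0\<close>.\<close>
  have proj': "is_orthogonal_projection (span (g ` {1..k})) f (F k)" for k
    using proj F0 by (cases k) (auto simp: is_orthogonal_projection_def orthogonal_def)
  have step: "(norm (r (Suc k)))\<^sup>2 \<le> (norm (r k))\<^sup>2 - (s k)\<^sup>2" for k
  proof -
    let ?c = "r k \<bullet> g (Suc k)"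
    have ng: "norm (g (Suc k)) = 1"
      using gD D by (simp add: dictionary_def)
    have "span (g ` {1..k}) \<subseteq> span (g ` {1..Suc k})"
      by (intro span_mono image_mono) simp
    moreover have "F k \<in> span (g ` {1..k})"
      using proj'[of k] by (simp add: is_orthogonal_projection_def)
    ultimately have "F k \<in> span (g ` {1..Suc k})" by (rule subsetD)
    \<comment> \<open>Competitor for the projection: removing from \<open>r k\<close> its component
      along the new unit vector lowers the squared norm by exactly
      \<open>(s k)\<^sup>2\<close>.\<close>
    then have "F k + ?c *\<^sub>R g (Suc k) \<in> span (g ` {1..Suc k})"
      by (intro span_add span_scale) (auto intro: span_base)
    from orthogonal_projection_best[OF proj' subspace_span this]
    have "norm (r (Suc k)) \<le> norm (r k - ?c *\<^sub>R g (Suc k))"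
      by (simp add: r_def diff_diff_eq)
    then have "(norm (r (Suc k)))\<^sup>2 \<le> (norm (r k - ?c *\<^sub>R g (Suc k)))\<^sup>2"
      by (simp add: power_mono)
    also have "\<dots> = (norm (r k))\<^sup>2 - (s k)\<^sup>2"
      using ng by (simp add: power2_norm_eq_inner inner_diff inner_commute s_def norm_eq_1)
        (simp add: power2_eq_square)
    finally show ?thesis .
  qed
  have "decseq (\<lambda>k. norm (r k))"
    unfolding decseq_Suc_iff
  proof
    fix k
    have "(norm (r (Suc k)))\<^sup>2 \<le> (norm (r k))\<^sup>2"
      using step[of k] zero_le_power2[of "s k"] by linarith
    then show "norm (r (Suc k)) \<le> norm (r k)" by (rule power2_le_imp_le) simp
  qed
  then obtain L where L: "(\<lambda>k. norm (r k)) \<longlonglongrightarrow> L" and "\<And>k. L \<le> norm (r k)"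
    using decseq_convergent[of "\<lambda>k. norm (r k)" 0] by auto
  have L0: "L \<ge> 0" using L by (rule LIMSEQ_le_const) auto
  \<comment> \<open>Successive differences of a convergent sequence vanish, and by
    \<open>step\<close> they dominate \<open>(s k)\<^sup>2\<close>.\<close>
  have "(\<lambda>k. (norm (r k))\<^sup>2 - (norm (r (Suc k)))\<^sup>2) \<longlonglongrightarrow> L\<^sup>2 - L\<^sup>2"
    by (intro tendsto_intros L LIMSEQ_Suc)
  then have "(\<lambda>k. (s k)\<^sup>2) \<longlonglongrightarrow> 0"
    by (intro tendsto_sandwich[of "\<lambda>_. 0" "\<lambda>k. (s k)\<^sup>2" sequentially
          "\<lambda>k. (norm (r k))\<^sup>2 - (norm (r (Suc k)))\<^sup>2"])
      (use step in \<open>auto simp: algebra_simps\<close>)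
  then have s: "s \<longlonglongrightarrow> 0"
    by simp
  have "L \<le> \<epsilon>" if "\<epsilon> > 0" for \<epsilon>
  proof -
    obtain h where h: "h \<in> span D" "norm (f - h) < \<epsilon>"
      using dictionary_approx[OF D \<open>\<epsilon> > 0\<close>] by blast
    obtain M where M: "\<And>w S. 0 \<le> S \<Longrightarrow> \<forall>g\<in>D. \<bar>w \<bullet> g\<bar> \<le> S \<Longrightarrow> \<bar>w \<bullet> h\<bar> \<le> M * S"
      using span_inner_bound[OF h(1)] by blast
    have "(norm (r k))\<^sup>2 \<le> M * s k + norm (r k) * \<epsilon>" for k
    proof -
      \<comment> \<open>The residual is orthogonal to its own approximant, so its squared norm is
        \<open>r k \<bullet> f\<close>, split here at \<open>h\<close>.\<close>
      have "r k \<bullet> F k = 0"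
        using proj'[of k] by (auto simp: is_orthogonal_projection_def orthogonal_def r_def)
      then have "(norm (r k))\<^sup>2 = r k \<bullet> h + r k \<bullet> (f - h)"
        by (simp add: power2_norm_eq_inner inner_diff_right) (simp add: r_def inner_diff_right)
      also have "r k \<bullet> h \<le> M * s k"
        using M[of "s k" "r k"] s_max by (force simp: s_def)
      also have "r k \<bullet> (f - h) \<le> norm (r k) * \<epsilon>"
        using norm_cauchy_schwarz[of "r k" "f - h"] h(2)
        by (meson less_imp_le mult_left_mono norm_ge_zero order_trans)
      finally show ?thesis by simp
    qed
    moreover have "(\<lambda>k. M * s k + norm (r k) * \<epsilon>) \<longlonglongrightarrow> M * 0 + L * \<epsilon>"
      by (intro tendsto_intros s L)
    moreover have "(\<lambda>k. (norm (r k))\<^sup>2) \<longlonglongrightarrow> L\<^sup>2"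
      by (intro tendsto_intros L)
    ultimately have "L\<^sup>2 \<le> M * 0 + L * \<epsilon>"
      by (intro LIMSEQ_le) auto
    then show "L \<le> \<epsilon>"
      using L0 that by (cases "L = 0") (auto simp: power2_eq_square)
  qed
  then have "L \<le> 0" by (rule dense_ge)
  with L L0 show ?thesis by (simp add: r_def)
qed

section \<open>Convergence of the relaxed greedy algorithm, beginning with its scalar
  recursions\<close>

lemma contraction_tendsto_0:
  fixes v :: "nat \<Rightarrow> real"
  assumes nonneg: "\<And>k. 0 \<le> v k"
    and step: "\<And>k. k \<ge> K \<Longrightarrow> v (Suc k) \<le> (1 - 1 / real (Suc k)) * v k"
  shows "v \<longlonglongrightarrow> 0"
proof -
  \<comment> \<open>\<open>real k * v k\<close> does not increase beyond \<open>K\<close>, because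
    \<open>Suc k * (1 - 1 / Suc k) = k\<close>; hence \<open>v k\<close> is O(1/k).\<close>
  have bound: "real k * v k \<le> real K * v K" if "k \<ge> K" for k
    using that
  proof (induction rule: dec_induct)
    case (step n)
    have "real (Suc n) * v (Suc n) \<le> real (Suc n) * ((1 - 1 / real (Suc n)) * v n)"
      using assms(2)[of n] step.hyps by (intro mult_left_mono) auto
    also have "\<dots> = real n * v n" by (simp add: field_simps)
    finally show ?case using step.IH by simp
  qed simp
  have "(\<lambda>k. real K * v K / real k) \<longlonglongrightarrow> 0" by (rule lim_const_over_n)
  moreover have "\<forall>\<^sub>F k in sequentially. v k \<le> real K * v K / real k"
    using eventually_ge_at_top[of "max K 1"]
    by eventually_elim (use bound in \<open>auto simp: field_simps\<close>)
  ultimately show ?thesis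
    using nonneg by (intro tendsto_sandwich[of "\<lambda>_. 0" v sequentially "\<lambda>k. real K * v K / real k"]) auto
qed

text \<open>Once \<open>a k * B\<close> is below a margin \<eta>, the quadratic term is absorbed by
  raising \<open>c\<close> to \<open>c + \<eta>\<close>; the excess over that level then contracts
  by at least the factor \<open>1 - 1 / Suc k\<close>.\<close>

lemma relaxed_recursion_eventually_le:
  fixes e a :: "nat \<Rightarrow> real"
  assumes a_lower: "\<And>k. 1 / real (Suc k) \<le> a k" and a_upper: "\<And>k. a k \<le> 1"
    and a_lim: "a \<longlonglongrightarrow> 0"
    and step: "\<And>k. e (Suc k) \<le> (1 - a k) * e k + a k * c + (a k)\<^sup>2 * B"
    and "\<delta> > 0"
  shows "\<forall>\<^sub>F k in sequentially. e k \<le> c + \<delta>"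
proof -
  \<comment> \<open>Half of \<delta> absorbs the quadratic term, the other half leaves room for the
    excess to decay.\<close>
  define \<eta> where "\<eta> = \<delta> / 2"
  have \<eta>: "\<eta> > 0" "\<delta> = \<eta> + \<eta>" using \<open>\<delta> > 0\<close> by (auto simp: \<eta>_def)
  \<comment> \<open>Truncation at 0 allows the factor \<open>1 - a k\<close> to be replaced by the
    larger \<open>1 - 1 / Suc k\<close>.\<close>
  define v where "v k = max 0 (e k - c - \<eta>)" for k
  have "(\<lambda>k. a k * B) \<longlonglongrightarrow> 0 * B" by (intro tendsto_intros a_lim)
  then have "\<forall>\<^sub>F k in sequentially. a k * B < \<eta>"
    using \<eta>(1) by (intro order_tendstoD) auto
  then obtain K where K: "\<And>k. k \<ge> K \<Longrightarrow> a k * B < \<eta>"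
    by (auto simp: eventually_sequentially)
  have "v (Suc k) \<le> (1 - 1 / real (Suc k)) * v k" if "k \<ge> K" for k
  proof -
    have a0: "0 \<le> a k" using a_lower[of k] by (meson order_trans zero_le_divide_1_iff of_nat_0_le_iff)
    have "(a k)\<^sup>2 * B \<le> a k * \<eta>"
      using mult_left_mono[OF less_imp_le[OF K[OF that]] a0] by (simp add: power2_eq_square mult.assoc)
    with step[of k] have "e (Suc k) - c - \<eta> \<le> (1 - a k) * (e k - c - \<eta>)"
      by (simp add: algebra_simps)
    also have "\<dots> \<le> (1 - a k) * v k"
      using a_upper[of k] by (intro mult_left_mono) (auto simp: v_def)
    also have "\<dots> \<le> (1 - 1 / real (Suc k)) * v k"
      using a_lower[of k] by (intro mult_right_mono) (auto simp: v_def)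
    finally show ?thesis unfolding v_def[of "Suc k"]
      by (simp add: v_def)
  qed
  then have "v \<longlonglongrightarrow> 0" by (intro contraction_tendsto_0) (auto simp: v_def)
  then have "\<forall>\<^sub>F k in sequentially. v k < \<eta>"
    using \<eta>(1) by (intro order_tendstoD) auto
  then show ?thesis by eventually_elim (auto simp: v_def \<eta>(2))
qed

text \<open>Minimality bounds every \<open>\<bar>w \<bullet> d\<bar>\<close> by one
  \<open>S\<close>, and \<open>M\<close> transfers this to \<open>h\<close>, as if a step of length
  \<open>a\<close> towards \<open>h\<close> itself were allowed at the cost of
  \<open>a\<^sup>2 * M\<^sup>2\<close>.\<close>

lemma rga_step:
  fixes f :: "'a::real_inner"
  assumes D: "\<forall>g\<in>D. norm g = 1"
    and M: "M > 0" "\<And>w S. 0 \<le> S \<Longrightarrow> \<forall>g\<in>D. \<bar>w \<bullet> g\<bar> \<le> S \<Longrightarrow> \<bar>w \<bullet> h\<bar> \<le> M * S"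
    and a: "0 < a" "a \<le> 1"
    and min: "is_arg_min (\<lambda>(b, h). norm (f - (1 - a) *\<^sub>R x - b *\<^sub>R h)) (\<lambda>(b, h). h \<in> D) (\<beta>, g)"
  shows "(norm (f - ((1 - a) *\<^sub>R x + \<beta> *\<^sub>R g)))\<^sup>2
    \<le> (1 - a) * (norm (f - x))\<^sup>2 + a * (norm (f - h))\<^sup>2 + a\<^sup>2 * M\<^sup>2"
proof -
  define w where "w = f - (1 - a) *\<^sub>R x"
  define e where "e = (norm (w - \<beta> *\<^sub>R g))\<^sup>2"
  \<comment> \<open>The solution of
    \<open>e = (norm w)\<^sup>2 - 2 * a * M * S + a\<^sup>2 * M\<^sup>2\<close>.\<close>
  define S where "S = ((norm w)\<^sup>2 + a\<^sup>2 * M\<^sup>2 - e) / (2 * a * M)"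
  have "g \<in> D" using min by (simp add: is_arg_min_def)
  have opt: "norm (w - \<beta> *\<^sub>R g) \<le> norm (w - b *\<^sub>R d)" if "d \<in> D" for b d
    using min that by (force simp: is_arg_min_linorder w_def)
  have bound: "\<bar>w \<bullet> d\<bar> \<le> S" if "d \<in> D" for d
  proof -
    \<comment> \<open>The sign turns \<open>w \<bullet> d\<close> into its absolute value;
      \<open>sgn 0 = 0\<close> makes \<open>b2\<close> an inequality only.\<close>
    define b where "b = a * M * sgn (w \<bullet> d)"
    have b1: "b * (w \<bullet> d) = a * M * \<bar>w \<bullet> d\<bar>" by (simp add: b_def abs_sgn mult.assoc mult.commute)
    have b2: "b\<^sup>2 \<le> a\<^sup>2 * M\<^sup>2" by (auto simp: b_def sgn_if power_mult_distrib)
    have "e \<le> (norm (w - b *\<^sub>R d))\<^sup>2"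
      unfolding e_def using opt[OF that] by (simp add: power_mono)
    also have "\<dots> = (norm w)\<^sup>2 - 2 * (b * (w \<bullet> d)) + b\<^sup>2"
      using D that by (simp add: power2_norm_eq_inner inner_diff inner_commute norm_eq_1)
        (simp add: power2_eq_square)
    also have "\<dots> \<le> (norm w)\<^sup>2 - 2 * (a * M * \<bar>w \<bullet> d\<bar>) + a\<^sup>2 * M\<^sup>2"
      using b1 b2 by simp
    finally show ?thesis
      using a M(1) by (simp add: S_def pos_le_divide_eq mult_ac)
  qed
  have "0 \<le> S" using bound[OF \<open>g \<in> D\<close>] by linarith
  with bound M(2)[of S w] have "w \<bullet> h \<le> M * S" by force
  also have "M * S = ((norm w)\<^sup>2 + a\<^sup>2 * M\<^sup>2 - e) / (2 * a)"
    using M(1) by (simp add: S_def)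
  finally have "e \<le> (norm w)\<^sup>2 - 2 * a * (w \<bullet> h) + a\<^sup>2 * M\<^sup>2"
    using a by (simp add: field_simps)
  \<comment> \<open>Completing the square adds \<open>a\<^sup>2 * (norm h)\<^sup>2\<close>, which is
    nonnegative.\<close>
  also have "\<dots> \<le> (norm (w - a *\<^sub>R h))\<^sup>2 + a\<^sup>2 * M\<^sup>2"
    using a by (simp add: power2_norm_eq_inner inner_diff inner_commute)
  also have "w - a *\<^sub>R h = (1 - a) *\<^sub>R (f - x) + a *\<^sub>R (f - h)"
    by (simp add: w_def algebra_simps)
  also have "(norm \<dots>)\<^sup>2 \<le> (1 - a) * (norm (f - x))\<^sup>2 + a * (norm (f - h))\<^sup>2"
  proof -
    \<comment> \<open>The exact defect in the convexity of the squared norm.\<close>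
    have "(1 - a) * (norm u)\<^sup>2 + a * (norm v)\<^sup>2 - (norm ((1 - a) *\<^sub>R u + a *\<^sub>R v))\<^sup>2
        = a * (1 - a) * (norm (u - v))\<^sup>2" for u v :: 'a
      by (simp add: power2_norm_eq_inner inner_diff inner_add inner_commute algebra_simps)
    moreover have "0 \<le> a * (1 - a) * (norm (f - x - (f - h)))\<^sup>2" using a by simp
    ultimately show ?thesis by (metis diff_ge_0_iff_ge)
  qed
  finally show ?thesis by (simp add: e_def w_def diff_diff_eq)
qed

text \<open>At index 1 both choices give \<open>1 - \<alpha> 1 = 1\<close>; the formula
  \<open>2 / k\<close> would exceed 1 there, hence the case split.\<close>

lemma rga_weights_bounds:
  assumes "rga_weights \<alpha>"
  shows "1 / real (Suc k) \<le> 1 - \<alpha> (Suc k)" "1 - \<alpha> (Suc k) \<le> 1" "1 - \<alpha> (Suc k) \<le> 2 / real (Suc k)"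
  using assms by (cases k; auto simp: rga_weights_def divide_right_mono)+

lemma rga_converges:
  assumes D: "dictionary D" and \<alpha>: "rga_weights \<alpha>" and "rga D \<alpha> f F"
  shows "(\<lambda>N. norm (f - F N)) \<longlonglongrightarrow> 0"
proof -
  from \<open>rga D \<alpha> f F\<close> obtain \<beta> g where
    run: "\<forall>k\<ge>1. is_arg_min (\<lambda>(b, h). norm (f - \<alpha> k *\<^sub>R F (k - 1) - b *\<^sub>R h)) (\<lambda>(b, h). h \<in> D)
        (\<beta> k, g k) \<and> F k = \<alpha> k *\<^sub>R F (k - 1) + \<beta> k *\<^sub>R g k"
    unfolding rga_def by blast
  have min: "is_arg_min (\<lambda>(b, h). norm (f - \<alpha> (Suc k) *\<^sub>R F k - b *\<^sub>R h)) (\<lambda>(b, h). h \<in> D)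
      (\<beta> (Suc k), g (Suc k))"
    and F: "F (Suc k) = \<alpha> (Suc k) *\<^sub>R F k + \<beta> (Suc k) *\<^sub>R g (Suc k)" for k
    using run[rule_format, of "Suc k"] by simp_all
  define a where "a k = 1 - \<alpha> (Suc k)" for k
  note bounds = rga_weights_bounds[OF \<alpha>, folded a_def]
  have pos: "0 < a k" for k
    using bounds(1)[of k] by (rule less_le_trans[rotated]) simp
  have "(\<lambda>k. 2 / real (Suc k)) \<longlonglongrightarrow> 0" by (rule LIMSEQ_Suc[OF lim_const_over_n])
  then have "a \<longlonglongrightarrow> 0"
    by (intro tendsto_sandwich[of "\<lambda>_. 0" a sequentially "\<lambda>k. 2 / real (Suc k)"]
        always_eventually allI tendsto_const bounds(3) less_imp_le[OF pos])
  have "\<forall>\<^sub>F k in sequentially. norm (f - F k) < \<epsilon>" if "\<epsilon> > 0" for \<epsilon>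
  proof -
    \<comment> \<open>With \<open>(\<epsilon> / 2)\<^sup>2\<close> also as the margin of the
      recursion, the squared error ends below \<open>2 * (\<epsilon> / 2)\<^sup>2\<close>, strictly
      less than \<open>\<epsilon>\<^sup>2\<close>.\<close>
    obtain h where h: "h \<in> span D" "norm (f - h) < \<epsilon> / 2"
      using dictionary_approx[OF D half_gt_zero[OF \<open>\<epsilon> > 0\<close>]] by blast
    obtain M where M: "M > 0"
      "\<And>w S. 0 \<le> S \<Longrightarrow> \<forall>g\<in>D. \<bar>w \<bullet> g\<bar> \<le> S \<Longrightarrow> \<bar>w \<bullet> h\<bar> \<le> M * S"
      using span_inner_bound[OF h(1)] by blast
    have "(norm (f - F (Suc k)))\<^sup>2
        \<le> (1 - a k) * (norm (f - F k))\<^sup>2 + a k * (norm (f - h))\<^sup>2 + (a k)\<^sup>2 * M\<^sup>2" for k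
      using rga_step[OF _ M pos[of k] bounds(2)[of k], where D = D and f = f and x = "F k"
          and \<beta> = "\<beta> (Suc k)" and g = "g (Suc k)"] min[of k] D F[of k]
      by (simp add: dictionary_def a_def)
    from relaxed_recursion_eventually_le[OF bounds(1,2) \<open>a \<longlonglongrightarrow> 0\<close> this, of "(\<epsilon> / 2)\<^sup>2"] that
    have le: "\<forall>\<^sub>F k in sequentially. (norm (f - F k))\<^sup>2 \<le> (norm (f - h))\<^sup>2 + (\<epsilon> / 2)\<^sup>2"
      by simp
    have lt: "(norm (f - h))\<^sup>2 + (\<epsilon> / 2)\<^sup>2 < \<epsilon>\<^sup>2"
    proof -
      have "(norm (f - h))\<^sup>2 \<le> (\<epsilon> / 2)\<^sup>2" using h(2) by (intro power_mono) auto
      moreover have "2 * (\<epsilon> / 2)\<^sup>2 < \<epsilon>\<^sup>2" using that by (simp add: power_divide)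
      ultimately show ?thesis by linarith
    qed
    from le show ?thesis
      by eventually_elim (rule power2_less_imp_less[OF le_less_trans[OF _ lt] less_imp_le[OF that]])
  qed
  then show ?thesis by (simp add: tendsto_iff)
qed

theorem corollary2p7:
  fixes D :: "'a::{real_inner, complete_space} set"
    and f :: 'a
    and F :: "nat \<Rightarrow> 'a"
  assumes "dictionary D"
    and "oga D f F \<or> (\<exists>\<alpha>. rga_weights \<alpha> \<and> rga D \<alpha> f F)"
  shows "(\<lambda>N. norm (f - F N)) \<longlonglongrightarrow> 0"
  using assms oga_converges rga_converges by blast

end
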